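(* Let $\mathsf{H}$ be a quaternionic Hilbert space, let $J\in\mathfrak{B}(\mathsf{H})$ be an anti self-adjoint and unitary operator and let $\imath\in\mathbb{S}$. For every $\mathbb{C}_\imath$-linear operator $T:D(T)\to\mathsf{H}^{J\imath}_+$ with $D(T)\subset\mathsf{H}^{J\imath}_+$ (a $\mathbb{C}_\imath$-linear subspace), there exists a unique right $\mathbb{H}$-linear operator $\tilde T:D(\tilde T)\to\mathsf{H}$ with $D(\tilde T)\subset\mathsf{H}$ such that $J(D(\tilde T))\subset D(\tilde T)$, $D(\tilde T)\cap\mathsf{H}^{J\imath}_+=D(T)$ and $\tilde T(u)=T(u)$ for every $u\in D(T)$. The following additional facts hold. (a) If $T\in\mathfrak{B}(\mathsf{H}^{J\imath}_+)$, then $\tilde T\in\mathfrak{B}(\mathsf{H})$ and $\|\tilde T\|=\|T\|$. (b) $J\tilde T=\tilde TJ$. (c) Let $V:D(V)\to\mathsf{H}$ be a right $\mathbb{H}$-linear operator with $D(V)\subset\mathsf{H}$. Then $V=\tilde U$ for some $\mathbb{C}_\imath$-linear operator $U:D(V)\cap\mathsf{H}^{J\imath}_+\to\mathsf{H}^{J\imath}_+$ if and only if $J(D(V))\subset D(V)$ and $JV=VJ$. (d) If $D(T)$ is dense in $\mathsf{H}^{J\imath}_+$, then $D(\tilde T)$ is dense in $\mathsf{H}$ and $(\tilde T)^*=\widetilde{T^*}$. Furthermore, given a $\mathbb{C}_\imath$-linear operator $S:D(S)\to\mathsf{H}^{J\imath}_+$ with $D(S)\subset\mathsf{H}^{J\imath}_+$,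 we have: (e) $\widetilde{ST}=\tilde S\tilde T$. (f) If $S$ is a right (resp. left) inverse of $T$, then $\tilde S$ is a right (resp. left) inverse of $\tilde T$. The same assertions hold with $\mathsf{H}^{J\imath}_-$ in place of $\mathsf{H}^{J\imath}_+$ throughout.
   Context: $\mathbb{H}$ denotes the quaternions, with conjugation $q\mapsto\overline q$; $\mathbb{S}=\{q\in\mathbb{H}:q^2=-1\}$; $\mathbb{C}_\imath=\{\alpha+\imath\beta:\alpha,\beta\in\mathbb{R}\}$. A quaternionic Hilbert space $\mathsf{H}$ is a nonzero right $\mathbb{H}$-module with a scalar product $\langle\cdot|\cdot\rangle$ valued in $\mathbb{H}$, right $\mathbb{H}$-linear in the second argument, with $\langle u|v\rangle=\overline{\langle v|u\rangle}$, $\langle u|u\rangle\ge0$ (zero only for $u=0$), complete for $\|u\|=\sqrt{\langle u|u\rangle}$. $\mathfrak{B}(\mathsf{H})$: everywhere defined bounded right $\mathbb{H}$-linear operators; domains of right $\mathbb{H}$-linear operators are right $\mathbb{H}$-linear subspaces. Anti self-adjoint: $J^*=-J$; unitary: $J^*J=JJ^*=\mathrm{I}$. $\mathsf{H}^{J\imath}_\pm:=\{u\in\mathsf{H}:Ju=\pm u\imath\}$; each is a nonzero complex Hilbert space over $\mathbb{C}_\imath\cong\mathbb{C}$ with scalar multiplication the right multiplication by $\mathbb{C}_\imath$ and scalar product the restriction of $\langle\cdot|\cdot\rangle$ (which is $\mathbb{C}_\imath$-valued there). Compositions have natural domain $D(ST)=\{x\in D(T):Tx\in D(S)\}$, and equalities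 of operators include equality of domains. Adjoints of densely defined operators are as usual: $D(T^* )=\{u:\exists w_u\ \langle w_u|v\rangle=\langle u|Tv\rangle\ \forall v\in D(T)\}$, $T^*u=w_u$ (in $\mathsf{H}$ or in $\mathsf{H}^{J\imath}_+$ respectively). *)

theory Defs
  imports "HOL-Analysis.Analysis"
begin

section \<open>Quaternions\<close>

datatype quat = Quat (qre: real) (qi: real) (qj: real) (qk: real)

lemma quat_eq_iff: "p = q \<longleftrightarrow> qre p = qre q \<and> qi p = qi q \<and> qj p = qj q \<and> qk p = qk q"
  by (cases p; cases q) simp

instantiation quat :: real_algebra_1
begin

definition "0 = Quat 0 0 0 0"
definition "1 = Quat 1 0 0 0"
definition "- p = Quat (- qre p) (- qi p) (- qj p) (- qk p)"
definition "p + q = Quat (qre p + qre q) (qi p + qi q) (qj p + qj q) (qk p + qk q)"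
definition "p - q = Quat (qre p - qre q) (qi p - qi q) (qj p - qj q) (qk p - qk q)"
definition "p * q = Quat
  (qre p * qre q - qi p * qi q - qj p * qj q - qk p * qk q)
  (qre p * qi q + qi p * qre q + qj p * qk q - qk p * qj q)
  (qre p * qj q - qi p * qk q + qj p * qre q + qk p * qi q)
  (qre p * qk q + qi p * qj q - qj p * qi q + qk p * qre q)"
definition "r *\<^sub>R p = Quat (r * qre p) (r * qi p) (r * qj p) (r * qk p)"

instance
  by standard
    (simp_all add: quat_eq_iff zero_quat_def one_quat_def uminus_quat_def plus_quat_def
      minus_quat_def times_quat_def scaleR_quat_def algebra_simps)

end

definition qconj :: "quat \<Rightarrow> quat" where
  "qconj q = Quat (qre q) (- qi q) (- qj q) (- qk q)"

definition imag_units :: "quat set" where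
  "imag_units = {q. q ^ 2 = - 1}"

text \<open>\<open>slice \<iota>\<close> is the complex plane spanned by \<open>1\<close> and \<open>\<iota>\<close>.\<close>

definition slice :: "quat \<Rightarrow> quat set" where
  "slice \<iota> = {of_real a + \<iota> * of_real b | a b. True}"


section \<open>Quaternionic Hilbert spaces\<close>

text \<open>
  The superclass \<^class>\<open>banach\<close> supplies the topology and completeness; the axioms
  \<open>scaleQ_of_real\<close> and \<open>norm_eq_sqrt_qinner\<close> tie its real scalar multiplication and its norm
  to the quaternionic structure. Reality of \<open>qinner u u\<close> follows from \<open>qinner_commute\<close>.
\<close>

class quaternionic_hilbert = banach +
  fixes scaleQ :: "'a \<Rightarrow> quat \<Rightarrow> 'a" (infixl "*\<^sub>Q" 75)
    and qinner :: "'a \<Rightarrow> 'a \<Rightarrow> quat"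
  assumes scaleQ_add_left: "(u + v) *\<^sub>Q q = u *\<^sub>Q q + v *\<^sub>Q q"
    and scaleQ_add_right: "u *\<^sub>Q (p + q) = u *\<^sub>Q p + u *\<^sub>Q q"
    and scaleQ_mult: "u *\<^sub>Q (p * q) = (u *\<^sub>Q p) *\<^sub>Q q"
    and scaleQ_one: "u *\<^sub>Q 1 = u"
    and scaleQ_of_real: "u *\<^sub>Q of_real r = r *\<^sub>R u"
    and qinner_add_right: "qinner u (v + w) = qinner u v + qinner u w"
    and qinner_scaleQ_right: "qinner u (v *\<^sub>Q q) = qinner u v * q"
    and qinner_commute: "qinner u v = qconj (qinner v u)"
    and qinner_ge_zero: "0 \<le> qre (qinner u u)"
    and qinner_eq_zero: "qinner u u = 0 \<Longrightarrow> u = 0"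
    and norm_eq_sqrt_qinner: "norm u = sqrt (qre (qinner u u))"
    and nontrivial: "\<exists>u. u \<noteq> 0"


text \<open>The quaternions themselves are an example.\<close>

instantiation quat :: real_normed_vector
begin

definition "norm q = norm ((qre q, qi q), (qj q, qk q))" for q :: quat
definition "sgn q = inverse (norm q) *\<^sub>R q" for q :: quat
definition "dist p q = norm (p - q)" for p q :: quat
definition "(uniformity :: (quat \<times> quat) filter) = (INF e\<in>{0 <..}. principal {(x, y). dist x y < e})"
definition "open U \<longleftrightarrow> (\<forall>x\<in>U. \<forall>\<^sub>F (x', y) in uniformity. x' = x \<longrightarrow> y \<in> U)" for U :: "quat set"

instance
proof
  define f where "f q = ((qre q, qi q), (qj q, qk q))" for q
  have norm_f: "norm q = norm (f q)" for q by (simp add: norm_quat_def f_def)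
  have f_add: "f (p + q) = f p + f q" and f_scale: "f (r *\<^sub>R p) = r *\<^sub>R f p"
    and f_0: "f p = 0 \<longleftrightarrow> p = 0" for p q r
    by (auto simp: f_def quat_eq_iff zero_quat_def plus_quat_def scaleR_quat_def zero_prod_def)
  show "norm (p + q) \<le> norm p + norm q" for p q :: quat
    by (simp add: norm_f f_add norm_triangle_ineq)
  show "norm (r *\<^sub>R p) = \<bar>r\<bar> * norm p" for r and p :: quat by (simp add: norm_f f_scale)
  show "norm p = 0 \<longleftrightarrow> p = 0" for p :: quat by (simp add: norm_f f_0)
qed (simp_all add: sgn_quat_def dist_quat_def uniformity_quat_def open_quat_def)

end

instantiation quat :: quaternionic_hilbert
begin

definition "u *\<^sub>Q q = u * q" for u q :: quat
definition "qinner u v = qconj u * v" for u v :: quat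

instance
proof
  note ops = quat_eq_iff zero_quat_def one_quat_def plus_quat_def minus_quat_def
    times_quat_def scaleR_quat_def of_real_def qconj_def scaleQ_quat_def qinner_quat_def
  fix u v w p q :: quat and r :: real
  show "(u + v) *\<^sub>Q q = u *\<^sub>Q q + v *\<^sub>Q q" "u *\<^sub>Q (p + q) = u *\<^sub>Q p + u *\<^sub>Q q"
    "u *\<^sub>Q (p * q) = (u *\<^sub>Q p) *\<^sub>Q q" "u *\<^sub>Q 1 = u"
    by (simp_all add: scaleQ_quat_def distrib_left distrib_right mult.assoc)
  show "qinner u (v + w) = qinner u v + qinner u w"
    "qinner u (v *\<^sub>Q q) = qinner u v * q"
    by (simp_all add: scaleQ_quat_def qinner_quat_def distrib_left mult.assoc)
  show "u *\<^sub>Q of_real r = r *\<^sub>R u" "qinner u v = qconj (qinner v u)" "0 \<le> qre (qinner u u)"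
    by (simp_all add: ops)
  show "norm u = sqrt (qre (qinner u u))"
    by (simp add: norm_quat_def norm_Pair ops power2_eq_square add_ac)
  then show "qinner u u = 0 \<Longrightarrow> u = 0"
    using norm_eq_zero[of u] by (simp add: zero_quat_def)
  show "\<exists>u::quat. u \<noteq> 0" by (rule exI[of _ 1]) simp
  define f where "f q = ((qre q, qi q), (qj q, qk q))" for q
  define g where "g = (\<lambda>((a, b), (c, d)). Quat a b c d)"
  have fg: "f (g x) = x" for x by (auto simp: f_def g_def split: prod.splits)
  have dist_f: "dist p q = dist (f p) (f q)" for p q
    by (simp add: dist_norm norm_quat_def f_def minus_quat_def)
  show "convergent X" if "Cauchy X" for X :: "nat \<Rightarrow> quat"
  proof -
    have "Cauchy (\<lambda>n. f (X n))" using that by (simp add: Cauchy_def dist_f)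
    then obtain l where "(\<lambda>n. f (X n)) \<longlonglongrightarrow> l" by (auto simp: Cauchy_convergent_iff convergent_def)
    then have "X \<longlonglongrightarrow> g l" by (simp add: lim_sequentially dist_f fg)
    then show ?thesis by (auto simp: convergent_def)
  qed
qed

end


section \<open>Operators\<close>

text \<open>
  An operator with domain is a partial function \<open>T :: 'h \<rightharpoonup> 'h\<close>: its domain is \<^term>\<open>dom T\<close>,
  equality of maps includes equality of domains, and \<^term>\<open>S \<circ>\<^sub>m T\<close> is the composition with
  its natural domain.

  The set \<open>R\<close> of scalars and the ambient space \<open>X\<close> are parameters: \<open>R = UNIV\<close>, \<open>X = UNIV\<close>
  gives operators in the quaternionic Hilbert space, while \<open>R = slice \<iota>\<close> and \<open>X\<close> an eigenspace
  of \<open>J\<close> gives operators in a complex Hilbert space. The norm, the scalar product and the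
  topology of \<open>X\<close> are the restricted ones.
\<close>

definition linear_op :: "quat set \<Rightarrow> 'h set \<Rightarrow> ('h::quaternionic_hilbert \<rightharpoonup> 'h) \<Rightarrow> bool" where
  "linear_op R X T \<longleftrightarrow>
     dom T \<subseteq> X \<and> ran T \<subseteq> X \<and> 0 \<in> dom T \<and>
     (\<forall>u\<in>dom T. \<forall>v\<in>dom T. T (u + v) = Some (the (T u) + the (T v))) \<and>
     (\<forall>u\<in>dom T. \<forall>q\<in>R. T (u *\<^sub>Q q) = Some (the (T u) *\<^sub>Q q))"

definition bounded_op :: "quat set \<Rightarrow> 'h set \<Rightarrow> ('h::quaternionic_hilbert \<rightharpoonup> 'h) \<Rightarrow> bool" where
  "bounded_op R X T \<longleftrightarrow>
     linear_op R X T \<and> dom T = X \<and> (\<exists>M. \<forall>u\<in>X. norm (the (T u)) \<le> M * norm u)"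

text \<open>As for \<^const>\<open>onorm\<close>, the term at \<open>u = 0\<close> is \<open>0 / 0 = 0\<close>.\<close>

definition op_norm :: "('h::quaternionic_hilbert \<rightharpoonup> 'h) \<Rightarrow> real" where
  "op_norm T = (SUP u\<in>dom T. norm (the (T u)) / norm u)"

definition id_op :: "'h set \<Rightarrow> ('h \<rightharpoonup> 'h)" where
  "id_op X = Some |` X"

text \<open>Meaningful when \<^term>\<open>dom T\<close> is dense in \<open>X\<close>, which makes \<open>w\<close> unique.\<close>

definition op_adjoint :: "'h set \<Rightarrow> ('h::quaternionic_hilbert \<rightharpoonup> 'h) \<Rightarrow> ('h \<rightharpoonup> 'h)" where
  "op_adjoint X T = (\<lambda>u.
     if u \<in> X \<and> (\<exists>w\<in>X. \<forall>v\<in>dom T. qinner w v = qinner u (the (T v)))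
     then Some (THE w. w \<in> X \<and> (\<forall>v\<in>dom T. qinner w v = qinner u (the (T v))))
     else None)"

definition anti_self_adjoint :: "('h::quaternionic_hilbert \<rightharpoonup> 'h) \<Rightarrow> bool" where
  "anti_self_adjoint J \<longleftrightarrow> op_adjoint UNIV J = map_option uminus \<circ> J"

definition unitary_op :: "('h::quaternionic_hilbert \<rightharpoonup> 'h) \<Rightarrow> bool" where
  "unitary_op J \<longleftrightarrow>
     op_adjoint UNIV J \<circ>\<^sub>m J = id_op UNIV \<and> J \<circ>\<^sub>m op_adjoint UNIV J = id_op UNIV"

definition H_plus :: "('h::quaternionic_hilbert \<rightharpoonup> 'h) \<Rightarrow> quat \<Rightarrow> 'h set" where
  "H_plus J \<iota> = {u. J u = Some (u *\<^sub>Q \<iota>)}"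

definition H_minus :: "('h::quaternionic_hilbert \<rightharpoonup> 'h) \<Rightarrow> quat \<Rightarrow> 'h set" where
  "H_minus J \<iota> = {u. J u = Some (- (u *\<^sub>Q \<iota>))}"


section \<open>Extensions of complex linear operators\<close>

definition invariant_under :: "('h \<rightharpoonup> 'h) \<Rightarrow> 'h set \<Rightarrow> bool" where
  "invariant_under J D \<longleftrightarrow> (\<lambda>u. the (J u)) ` D \<subseteq> D"

definition is_extension ::
  "('h::quaternionic_hilbert \<rightharpoonup> 'h) \<Rightarrow> 'h set \<Rightarrow> ('h \<rightharpoonup> 'h) \<Rightarrow> ('h \<rightharpoonup> 'h) \<Rightarrow> bool" where
  "is_extension J K T V \<longleftrightarrow>
     linear_op UNIV UNIV V \<and> invariant_under J (dom V) \<and>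
     dom V \<inter> K = dom T \<and> (\<forall>u\<in>dom T. V u = T u)"

text \<open>
  Meaningful for \<open>slice \<iota>\<close>-linear operators \<open>T\<close> in \<open>K = H_plus J \<iota>\<close> or \<open>K = H_minus J \<iota>\<close>, where
  exactly one such \<open>V\<close> exists.
\<close>

definition tilde ::
  "('h::quaternionic_hilbert \<rightharpoonup> 'h) \<Rightarrow> 'h set \<Rightarrow> ('h \<rightharpoonup> 'h) \<Rightarrow> ('h \<rightharpoonup> 'h)" where
  "tilde J K T = (THE V. is_extension J K T V)"

end

(* With e = \<iota> for H_plus and e = - \<iota> for H_minus, the eigenspace is K = {u. J u = u e}. Let k be
   an imaginary unit anticommuting with e. Right multiplication by k maps K onto {u. J u = - u e},
   so every vector is u = a + b k for unique a = A u and b = B u in K, and orthogonality gives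
   |u|^2 = |a|^2 + |b|^2. A J-invariant right linear domain contains a and b along with u, because
   A u and B u are quaternionic combinations of u and J u. Hence the only possible extension is
   a + b k \<mapsto> T a + (T b) k, and the claims reduce to the two components. *)

theory Submission
  imports Defs
begin

section \<open>Quaternions\<close>

lemmas quat_defs = quat_eq_iff zero_quat_def one_quat_def uminus_quat_def plus_quat_def
  minus_quat_def times_quat_def scaleR_quat_def of_real_def

lemma imag_units_iff: "e \<in> imag_units \<longleftrightarrow> e * e = - 1"
  by (simp add: imag_units_def power2_eq_square)

lemma imag_units_components:
  assumes "e \<in> imag_units"
  shows "qre e = 0" "(qi e)\<^sup>2 + (qj e)\<^sup>2 + (qk e)\<^sup>2 = 1"
proof -
  have eqs: "qre e * qre e - qi e * qi e - qj e * qj e - qk e * qk e = -1"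
    "qre e * qi e = 0" "qre e * qj e = 0" "qre e * qk e = 0"
    using assms by (simp_all add: imag_units_iff quat_defs mult.commute)
  show "qre e = 0"
  proof (rule ccontr)
    assume "qre e \<noteq> 0"
    with eqs have "qre e * qre e = -1" by simp
    then show False by (metis neg_0_le_iff_le not_one_le_zero zero_le_square)
  qed
  with eqs(1) show "(qi e)\<^sup>2 + (qj e)\<^sup>2 + (qk e)\<^sup>2 = 1"
    by (simp add: power2_eq_square)
qed

text \<open>The slice of \<open>e\<close> is the commutant of \<open>e\<close>, which makes membership an algebraic condition.\<close>

lemma mem_slice_iff:
  assumes "e \<in> imag_units"
  shows "z \<in> slice e \<longleftrightarrow> e * z = z * e"
proof
  assume "z \<in> slice e"
  then show "e * z = z * e"
    by (auto simp: slice_def quat_defs)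
next
  assume "e * z = z * e"
  moreover note e = imag_units_components[OF assms]
  ultimately have eqs: "qj e * qk z = qk e * qj z" "qk e * qi z = qi e * qk z" "qi e * qj z = qj e * qi z"
    by (simp_all add: quat_defs algebra_simps)
  \<comment> \<open>The three equations say that the vector parts of \<open>e\<close> and
    \<open>z\<close> have zero cross product. Since \<open>e\<close> is a unit vector, the vector
    part of \<open>z\<close> is its projection, \<open>s\<close> times that of
    \<open>e\<close>.\<close>
  define s where "s = qi e * qi z + qj e * qj z + qk e * qk z"
  have "qi e * s = ((qi e)\<^sup>2 + (qj e)\<^sup>2 + (qk e)\<^sup>2) * qi z"
    using eqs unfolding s_def by algebra
  moreover have "qj e * s = ((qi e)\<^sup>2 + (qj e)\<^sup>2 + (qk e)\<^sup>2) * qj z"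
    using eqs unfolding s_def by algebra
  moreover have "qk e * s = ((qi e)\<^sup>2 + (qj e)\<^sup>2 + (qk e)\<^sup>2) * qk z"
    using eqs unfolding s_def by algebra
  ultimately have "z = of_real (qre z) + e * of_real s"
    using e by (simp add: quat_defs)
  then show "z \<in> slice e" unfolding slice_def by blast
qed

text \<open>The opposite eigenspace is reached by replacing \<iota> with its negative; the complex
  scalars stay the same.\<close>

lemma slice_uminus: "slice (- e) = slice e"
proof -
  have "slice (- e) \<subseteq> slice e" for e
  proof
    fix z assume "z \<in> slice (- e)"
    then obtain a b where "z = of_real a + e * of_real (- b)" by (auto simp: slice_def)
    then show "z \<in> slice e" unfolding slice_def by blast
  qed
  from this[of e] this[of "- e"] show ?thesis by auto
qed

text \<open>Imaginary units with orthogonal vector parts anticommute, so any unit vector orthogonal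
  to \<open>e\<close> will do.\<close>

lemma imag_units_anticommuting:
  assumes "e \<in> imag_units"
  obtains k where "k \<in> imag_units" "k * e = - (e * k)"
proof (cases "(qi e)\<^sup>2 + (qj e)\<^sup>2 = 0")
  case True
  \<comment> \<open>Here \<open>e\<close> is plus or minus the third basis unit, to which the first
    one is orthogonal.\<close>
  then have "qi e = 0" "qj e = 0" by (simp_all add: sum_power2_eq_zero_iff)
  with imag_units_components[OF assms] show ?thesis
    by (intro that[of "Quat 0 1 0 0"]) (simp_all add: imag_units_iff quat_defs)
next
  case False
  define r where "r = sqrt ((qi e)\<^sup>2 + (qj e)\<^sup>2)"
  have r: "r * r = (qi e)\<^sup>2 + (qj e)\<^sup>2" "r \<noteq> 0"
    using False by (simp_all add: r_def)
  \<comment> \<open>The witness is the projection of \<open>e\<close> to the first two imaginary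
    coordinates, turned by a right angle and normalised.\<close>
  show ?thesis
  proof (rule that[of "Quat 0 (- qj e / r) (qi e / r) 0"])
    have "qj e * qj e / (r * r) + qi e * qi e / (r * r) = 1"
      using False unfolding r(1) by (simp add: power2_eq_square add.commute flip: add_divide_distrib)
    then show "Quat 0 (- qj e / r) (qi e / r) 0 \<in> imag_units"
      by (simp add: imag_units_iff quat_defs algebra_simps)
    show "Quat 0 (- qj e / r) (qi e / r) 0 * e = - (e * Quat 0 (- qj e / r) (qi e / r) 0)"
      using imag_units_components[OF assms] by (simp add: quat_defs)
  qed
qed

lemma qconj_simps [simp]:
  "qconj (p + q) = qconj p + qconj q" "qconj (p - q) = qconj p - qconj q"
  "qconj (- q) = - qconj q" "qconj (p * q) = qconj q * qconj p" "qconj 0 = 0"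
  "qconj (qconj q) = q"
  by (simp_all add: quat_defs qconj_def algebra_simps)

lemma qconj_imag_unit: "e \<in> imag_units \<Longrightarrow> qconj e = - e"
  using imag_units_components[of e] by (simp add: quat_defs qconj_def)

lemma qre_simps [simp]:
  "qre 0 = 0" "qre (p + q) = qre p + qre q" "qre (p - q) = qre p - qre q" "qre (- q) = - qre q"
  by (simp_all add: quat_defs)

lemma qre_mult_commute: "qre (p * q) = qre (q * p)"
  by (simp add: quat_defs)


section \<open>Quaternionic Hilbert spaces\<close>

lemma scaleQ_zero_left [simp]: "0 *\<^sub>Q q = 0"
  using scaleQ_add_left[of 0 0 q] by simp

lemma scaleQ_zero_right [simp]: "u *\<^sub>Q 0 = 0"
  using scaleQ_add_right[of u 0 0] by simp

lemma scaleQ_minus_left [simp]: "(- u) *\<^sub>Q q = - (u *\<^sub>Q q)"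
  using scaleQ_add_left[of "- u" u q] by (simp add: eq_neg_iff_add_eq_0)

lemma scaleQ_minus_right [simp]: "u *\<^sub>Q (- q) = - (u *\<^sub>Q q)"
  using scaleQ_add_right[of u "- q" q] by (simp add: eq_neg_iff_add_eq_0)

lemma scaleQ_diff_left: "(u - v) *\<^sub>Q q = u *\<^sub>Q q - v *\<^sub>Q q"
  using scaleQ_add_left[of u "- v" q] by simp

lemma scaleQ_scaleR: "(r *\<^sub>R u) *\<^sub>Q q = r *\<^sub>R (u *\<^sub>Q q)"
proof -
  have "of_real r * q = q * of_real r" by (simp add: quat_defs)
  then show ?thesis by (metis scaleQ_mult scaleQ_of_real)
qed

lemma qinner_add_left: "qinner (u + v) w = qinner u w + qinner v w"
  by (metis qconj_simps(1) qinner_add_right qinner_commute)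

lemma qinner_scaleQ_left: "qinner (u *\<^sub>Q q) v = qconj q * qinner u v"
  by (metis qconj_simps(4) qinner_scaleQ_right qinner_commute)

lemma qinner_zero_right [simp]: "qinner u 0 = 0"
  using qinner_add_right[of u 0 0] by simp

lemma qinner_zero_left [simp]: "qinner 0 u = 0"
  using qinner_add_left[of 0 0 u] by simp

lemma qinner_minus_right [simp]: "qinner u (- v) = - qinner u v"
  using qinner_add_right[of u "- v" v] by (simp add: eq_neg_iff_add_eq_0)

lemma qinner_minus_left [simp]: "qinner (- u) v = - qinner u v"
  using qinner_add_left[of "- u" u v] by (simp add: eq_neg_iff_add_eq_0)

lemma qinner_diff_left: "qinner (u - v) w = qinner u w - qinner v w"
  using qinner_add_left[of u "- v" w] by simp

lemma norm_sq: "(norm u)\<^sup>2 = qre (qinner u u)"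
  by (simp add: norm_eq_sqrt_qinner qinner_ge_zero)

lemma qre_qinner_commute: "qre (qinner u v) = qre (qinner v u)"
  by (subst qinner_commute) (simp add: qconj_def)

lemma norm_sq_add: "(norm (u + v))\<^sup>2 = (norm u)\<^sup>2 + (norm v)\<^sup>2 + 2 * qre (qinner u v)"
  using qre_qinner_commute[of u v] by (simp add: norm_sq qinner_add_left qinner_add_right)

lemma norm_scaleQ_imag_unit:
  assumes "k \<in> imag_units"
  shows "norm (u *\<^sub>Q k) = norm u"
proof -
  have "qre (qconj k * (qinner u u * k)) = qre (qinner u u * k * qconj k)"
    by (rule qre_mult_commute)
  also have "\<dots> = qre (qinner u u)"
    using assms by (simp add: qconj_imag_unit mult.assoc imag_units_iff)
  finally show ?thesis
    by (simp add: norm_eq_sqrt_qinner qinner_scaleQ_left qinner_scaleQ_right mult.assoc)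
qed

text \<open>By Pythagoras every \<open>v\<close> in \<open>D\<close> has distance at least
  \<open>norm u\<close> from \<open>u\<close>, so a nonzero \<open>u\<close> cannot be approximated
  from \<open>D\<close>.\<close>

lemma orthogonal_to_dense_eq_0:
  assumes "u \<in> closure D" and orth: "\<And>v. v \<in> D \<Longrightarrow> qinner u v = 0"
  shows "u = 0"
proof (rule ccontr)
  assume "u \<noteq> 0"
  then have "0 < norm u" by simp
  with assms(1) obtain v where v: "v \<in> D" "dist v u < norm u"
    unfolding closure_approachable by blast
  have "qre (qinner v (- u)) = 0"
    using orth[OF v(1)] qre_qinner_commute[of v u] by simp
  then have "(norm u)\<^sup>2 \<le> (norm (v - u))\<^sup>2"
    using norm_sq_add[of v "- u"] by simp
  then have "norm u \<le> norm (v - u)" by (rule power2_le_imp_le) simp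
  with v(2) show False by (simp add: dist_norm)
qed


section \<open>Operators\<close>

lemma linear_opD:
  assumes "linear_op R X T"
  shows "T u = Some u' \<Longrightarrow> u \<in> X" "T u = Some u' \<Longrightarrow> u' \<in> X" "T 0 = Some 0"
    "T u = Some u' \<Longrightarrow> T v = Some v' \<Longrightarrow> T (u + v) = Some (u' + v')"
    "T u = Some u' \<Longrightarrow> q \<in> R \<Longrightarrow> T (u *\<^sub>Q q) = Some (u' *\<^sub>Q q)"
proof -
  note T = assms[unfolded linear_op_def]
  show "T u = Some u' \<Longrightarrow> u \<in> X" "T u = Some u' \<Longrightarrow> u' \<in> X"
    using T by (auto intro: ranI)
  \<comment> \<open>The scalar set \<open>R\<close> is arbitrary and may lack \<open>0\<close>, so
    the value at \<open>0\<close> comes from additivity.\<close>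
  have "T (0 + 0) = Some (the (T 0) + the (T 0))" using T by blast
  then show "T 0 = Some 0" by (metis add_cancel_right_right add_0 option.sel)
  show "T u = Some u' \<Longrightarrow> T v = Some v' \<Longrightarrow> T (u + v) = Some (u' + v')"
    "T u = Some u' \<Longrightarrow> q \<in> R \<Longrightarrow> T (u *\<^sub>Q q) = Some (u' *\<^sub>Q q)"
    using T by (metis domI option.sel)+
qed

lemma linear_opI:
  assumes "\<And>u u'. T u = Some u' \<Longrightarrow> u \<in> X \<and> u' \<in> X" "T 0 = Some 0"
    "\<And>u u' v v'. T u = Some u' \<Longrightarrow> T v = Some v' \<Longrightarrow> T (u + v) = Some (u' + v')"
    "\<And>u u' q. T u = Some u' \<Longrightarrow> q \<in> R \<Longrightarrow> T (u *\<^sub>Q q) = Some (u' *\<^sub>Q q)"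
  shows "linear_op R X T"
  unfolding linear_op_def
proof (intro conjI ballI)
  show "dom T \<subseteq> X" "ran T \<subseteq> X" "0 \<in> dom T"
  proof -
    show "dom T \<subseteq> X" "ran T \<subseteq> X"
      using assms(1) unfolding dom_def ran_def by fast+
    show "0 \<in> dom T" using assms(2) by (rule domI)
  qed
  show "T (u + v) = Some (the (T u) + the (T v))" if "u \<in> dom T" "v \<in> dom T" for u v
    using assms(3)[of u "the (T u)" v "the (T v)"] that by (simp add: domIff)
  show "T (u *\<^sub>Q q) = Some (the (T u) *\<^sub>Q q)" if "u \<in> dom T" "q \<in> R" for u q
    using assms(4)[of u "the (T u)" q] that by (simp add: domIff)
qed

lemma linear_op_comp:
  assumes "linear_op R X S" "linear_op R X T"
  shows "linear_op R X (S \<circ>\<^sub>m T)"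
proof -
  note S = linear_opD[OF assms(1)] and T = linear_opD[OF assms(2)]
  show ?thesis
  proof (rule linear_opI)
    show "u \<in> X \<and> u' \<in> X" if "(S \<circ>\<^sub>m T) u = Some u'" for u u'
      using that S(2) T(1) unfolding map_comp_Some_iff by blast
    show "(S \<circ>\<^sub>m T) 0 = Some 0"
      by (simp add: S(3) T(3))
    show "(S \<circ>\<^sub>m T) (u + v) = Some (u' + v')"
      if "(S \<circ>\<^sub>m T) u = Some u'" "(S \<circ>\<^sub>m T) v = Some v'" for u u' v v'
      using that S(4) T(4) unfolding map_comp_Some_iff by blast
    show "(S \<circ>\<^sub>m T) (u *\<^sub>Q q) = Some (u' *\<^sub>Q q)" if "(S \<circ>\<^sub>m T) u = Some u'" "q \<in> R" for u u' q
      using that S(5) T(5) unfolding map_comp_Some_iff by blast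
  qed
qed

text \<open>This eliminates the definite description. Two candidates for \<open>w\<close> differ by
  a vector of \<open>X\<close> orthogonal to \<open>dom T\<close>, and density makes that vector
  zero.\<close>

lemma op_adjoint_Some_iff:
  assumes dense: "X \<subseteq> closure (dom T)" and diff: "\<And>w w'. w \<in> X \<Longrightarrow> w' \<in> X \<Longrightarrow> w - w' \<in> X"
  shows "op_adjoint X T u = Some w \<longleftrightarrow>
    u \<in> X \<and> w \<in> X \<and> (\<forall>v v'. T v = Some v' \<longrightarrow> qinner w v = qinner u v')"
proof -
  let ?P = "\<lambda>w. w \<in> X \<and> (\<forall>v\<in>dom T. qinner w v = qinner u (the (T v)))"
  have P: "?P w \<longleftrightarrow> w \<in> X \<and> (\<forall>v v'. T v = Some v' \<longrightarrow> qinner w v = qinner u v')" for w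
    by (auto simp: dom_def)
  have unique: "w = w'" if "?P w" "?P w'" for w w'
  proof -
    have "w - w' = 0"
      using that dense diff by (intro orthogonal_to_dense_eq_0[of _ "dom T"]) (auto simp: qinner_diff_left)
    then show ?thesis by simp
  qed
  have the: "(THE w. ?P w) = w" if "?P w" for w
    using that unique by (intro the_equality) blast+
  show ?thesis
    unfolding P[of w, symmetric] op_adjoint_def using the by auto
qed


section \<open>The decomposition along an eigenspace\<close>

text \<open>The total function \<open>f\<close> stands for \<open>J\<close>. Anti self-adjointness
  is \<open>f_skew\<close>, and together with unitarity it gives \<open>f_f\<close>. Leaving
  \<open>e\<close> open covers both eigenspaces at once.\<close>

locale eigenspace_decomposition =
  fixes f :: "'h::quaternionic_hilbert \<Rightarrow> 'h" and e k :: quat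
  assumes f_add: "f (u + v) = f u + f v"
    and f_scaleQ: "f (u *\<^sub>Q q) = f u *\<^sub>Q q"
    and f_f: "f (f u) = - u"
    and f_skew: "qinner (f u) v = - qinner u (f v)"
    and e: "e \<in> imag_units" and k: "k \<in> imag_units" and anticommute: "k * e = - (e * k)"
begin

section \<open>The eigenspace and the two component maps\<close>

definition K :: "'h set" where "K = {u. f u = u *\<^sub>Q e}"

text \<open>The map sending \<open>u\<close> to \<open>f u *\<^sub>Q e\<close> is an involution, -1
  on \<open>K\<close> and +1 on the opposite eigenspace; \<open>A\<close> is its spectral projection
  onto \<open>K\<close>.\<close>

definition A :: "'h \<Rightarrow> 'h" where "A u = (1/2) *\<^sub>R (u - f u *\<^sub>Q e)"

text \<open>The complementary projection, carried from the opposite eigenspace back to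
  \<open>K\<close> by right multiplication with \<open>- k\<close>, the inverse of
  \<open>k\<close>.\<close>

definition B :: "'h \<Rightarrow> 'h" where "B u = - ((1/2) *\<^sub>R ((u + f u *\<^sub>Q e) *\<^sub>Q k))"

lemma ee: "e * e = - 1" and kk: "k * k = - 1"
  using e k by (simp_all add: imag_units_iff)

lemma scaleQ_ee [simp]: "u *\<^sub>Q e *\<^sub>Q e = - u" for u :: 'h
  by (simp add: ee scaleQ_one flip: scaleQ_mult)

lemma scaleQ_kk [simp]: "u *\<^sub>Q k *\<^sub>Q k = - u" for u :: 'h
  by (simp add: kk scaleQ_one flip: scaleQ_mult)

lemma scaleQ_ke [simp]: "u *\<^sub>Q k *\<^sub>Q e = - (u *\<^sub>Q e *\<^sub>Q k)" for u :: 'h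
  by (simp add: anticommute flip: scaleQ_mult)

lemma slice_iff: "z \<in> slice e \<longleftrightarrow> e * z = z * e"
  by (rule mem_slice_iff[OF e])

lemma f_minus: "f (- u) = - f u"
  using f_scaleQ[of u "- 1"] by (simp add: scaleQ_one)

lemma f_diff: "f (u - v) = f u - f v"
  using f_add[of u "- v"] by (simp add: f_minus)

lemma f_scaleR: "f (r *\<^sub>R u) = r *\<^sub>R f u"
  by (simp add: f_scaleQ flip: scaleQ_of_real)

lemmas f_simps = f_add f_diff f_minus f_scaleR f_scaleQ f_f

lemma K_zero: "0 \<in> K" and K_add: "u \<in> K \<Longrightarrow> v \<in> K \<Longrightarrow> u + v \<in> K"
  and K_diff: "u \<in> K \<Longrightarrow> v \<in> K \<Longrightarrow> u - v \<in> K"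
  using f_diff[of 0 0] by (simp_all add: K_def f_simps scaleQ_add_left scaleQ_diff_left)

lemma K_scaleQ: "u \<in> K \<Longrightarrow> z \<in> slice e \<Longrightarrow> u *\<^sub>Q z \<in> K"
  by (simp add: K_def f_simps slice_iff flip: scaleQ_mult)

lemma half_add_half: "(1/2) *\<^sub>R u + (1/2) *\<^sub>R u = u" for u :: "'b::real_vector"
  using scaleR_half_double[of u] by (simp only: scaleR_add_right)

lemmas linear_simps = f_simps scaleQ_add_left scaleQ_diff_left scaleQ_scaleR scaleR_add_right
  scaleR_diff_right half_add_half

lemma A_in_K: "A u \<in> K"
  by (simp add: K_def A_def linear_simps)

lemma B_in_K: "B u \<in> K"
  by (simp add: K_def B_def linear_simps)

lemma A_B_sum: "A u + B u *\<^sub>Q k = u"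
  by (simp add: A_def B_def linear_simps)

text \<open>Since \<open>k\<close> anticommutes with \<open>e\<close>, the vector
  \<open>b *\<^sub>Q k\<close> lies in the opposite eigenspace and is killed by \<open>A\<close>,
  while \<open>B\<close> kills \<open>a\<close>. Components can thus be read off any such
  sum.\<close>

lemma
  assumes "a \<in> K" "b \<in> K"
  shows A_sum: "A (a + b *\<^sub>Q k) = a" and B_sum: "B (a + b *\<^sub>Q k) = b"
  using assms by (simp_all add: K_def A_def B_def linear_simps)

lemma A_K: "a \<in> K \<Longrightarrow> A a = a" and B_K: "a \<in> K \<Longrightarrow> B a = 0"
  using A_sum[OF _ K_zero] B_sum[OF _ K_zero] by simp_all

lemma A_zero: "A 0 = 0" and B_zero: "B 0 = 0"
  by (simp_all add: A_K B_K K_zero)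

lemma A_add: "A (u + v) = A u + A v" and B_add: "B (u + v) = B u + B v"
  by (simp_all add: A_def B_def linear_simps)

lemma f_sum: "f u = A u *\<^sub>Q e + B u *\<^sub>Q e *\<^sub>Q k"
  using A_in_K[of u] B_in_K[of u]
  by (subst A_B_sum[of u, symmetric]) (simp add: f_simps K_def)

lemma e_in_slice: "e \<in> slice e"
  by (simp add: slice_iff)

text \<open>In \<open>f_sum\<close> the factor \<open>e\<close> stands to the left of
  \<open>k\<close>, so \<open>f\<close> acts on both components alike, as a slice scalar.\<close>

lemma A_f: "A (f u) = A u *\<^sub>Q e" and B_f: "B (f u) = B u *\<^sub>Q e"
  unfolding f_sum[of u]
  by (intro A_sum B_sum K_scaleQ A_in_K B_in_K e_in_slice)+

section \<open>Quaternionic scalars in components\<close>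

lemma slice_k:
  assumes "z \<in> slice e"
  shows "k * z * k \<in> slice e"
proof -
  have ek: "e * k = - (k * e)" and z: "e * z = z * e"
    using assms by (simp_all add: anticommute slice_iff)
  \<comment> \<open>Carrying \<open>e\<close> past the two factors \<open>k\<close> changes the sign
    twice.\<close>
  have "e * (k * z * k) = (e * k) * z * k" by (simp add: mult.assoc)
  also have "\<dots> = - (k * (e * z) * k)" by (simp add: ek mult.assoc)
  also have "\<dots> = - (k * z * (e * k))" by (simp add: z mult.assoc)
  also have "\<dots> = k * z * k * e" by (simp add: ek mult.assoc)
  finally show ?thesis by (simp add: slice_iff)
qed

lemma quat_decomp:
  obtains z w where "z \<in> slice e" "w \<in> slice e" "q = z + w * k"
proof
  \<comment> \<open>\<open>?p\<close> and \<open>?m\<close> are the parts of \<open>q\<close> that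
    commute and anticommute with \<open>e\<close>; multiplying \<open>?m\<close> by \<open>k\<close>
    gives an element commuting with \<open>e\<close>.\<close>
  let ?p = "(1/2) *\<^sub>R (q - e * q * e)" and ?m = "(1/2) *\<^sub>R (q + e * q * e)"
  have ee': "e * (e * x) = - x" for x by (simp add: ee flip: mult.assoc)
  show "?p \<in> slice e"
    by (simp add: slice_iff algebra_simps ee ee')
  show "- (?m * k) \<in> slice e"
    by (simp add: slice_iff algebra_simps ee ee' anticommute)
  show "q = ?p + - (?m * k) * k"
    by (simp add: algebra_simps kk half_add_half)
qed

lemma
  assumes "z \<in> slice e" "w \<in> slice e"
  shows A_scaleQ: "A (u *\<^sub>Q (z + w * k)) = A u *\<^sub>Q z + B u *\<^sub>Q (k * w * k)"
    and B_scaleQ: "B (u *\<^sub>Q (z + w * k)) = A u *\<^sub>Q w + B u *\<^sub>Q - (k * z * k)"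
proof -
  have "u *\<^sub>Q (z + w * k) =
      (A u + B u *\<^sub>Q k) *\<^sub>Q (z + w * k)" by (simp only: A_B_sum)
  \<comment> \<open>As \<open>k * k = - 1\<close>, the product \<open>k * z\<close> equals
    \<open>- (k * z * k) * k\<close>; this gives the mixed term the form of a slice multiple of
    \<open>B u\<close> followed by \<open>k\<close>.\<close>
  also have "\<dots> = (A u *\<^sub>Q z + B u *\<^sub>Q (k * w * k)) + (A u *\<^sub>Q w + B u *\<^sub>Q - (k * z * k)) *\<^sub>Q k"
    by (simp add: scaleQ_add_left scaleQ_diff_left scaleQ_add_right scaleQ_mult add.commute)
  finally have *: "u *\<^sub>Q (z + w * k) = \<dots>" .
  have "- (k * z * k) \<in> slice e"
    using slice_k[OF assms(1)] by (simp add: slice_iff)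
  then show "A (u *\<^sub>Q (z + w * k)) = A u *\<^sub>Q z + B u *\<^sub>Q (k * w * k)"
    "B (u *\<^sub>Q (z + w * k)) = A u *\<^sub>Q w + B u *\<^sub>Q - (k * z * k)"
    unfolding * using assms
    by (intro A_sum B_sum K_add K_scaleQ A_in_K B_in_K slice_k; simp)+
qed

section \<open>Scalar products and norms in components\<close>

lemma qinner_K:
  assumes "a \<in> K" "b \<in> K"
  shows "qinner a b \<in> slice e"
proof -
  \<comment> \<open>\<open>f\<close> preserves the scalar product and multiplies vectors of
    \<open>K\<close> by \<open>e\<close>. Pulling both factors out turns this invariance into
    commutation with \<open>e\<close>.\<close>
  have "qinner a b = qinner (f a) (f b)" by (simp add: f_skew f_f)
  also have "\<dots> = - (e * qinner a b * e)"
    using assms by (simp add: K_def qinner_scaleQ_left qinner_scaleQ_right qconj_imag_unit[OF e] mult.assoc)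
  finally have "e * qinner a b = - (e * e * qinner a b * e)"
    by (metis mult.assoc mult_minus_right)
  then show ?thesis by (simp add: slice_iff ee)
qed

text \<open>Multiples of \<open>k\<close> by slice elements anticommute with \<open>e\<close>, so
  only zero is both such a multiple and in the slice. This separates the contributions of
  \<open>A\<close> and \<open>B\<close> to a scalar product.\<close>

lemma slice_add_k_eq:
  assumes "z \<in> slice e" "w \<in> slice e" "z' \<in> slice e" "w' \<in> slice e"
    and "z + k * w = z' + k * w'"
  shows "z = z' \<and> w = w'"
proof -
  define x y where "x = z - z'" and "y = w - w'"
  have x: "e * x = x * e" and y: "e * y = y * e"
    using assms(1-4) by (simp_all add: x_def y_def slice_iff algebra_simps)
  have xy: "x = - (k * y)" using assms(5) by (simp add: x_def y_def algebra_simps eq_neg_iff_add_eq_0)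
  have "e * (k * y) = - (k * (e * y))" 
    using anticommute by (simp flip: mult.assoc)
  then have "e * x = - (x * e)" using xy y by (simp add: mult.assoc)
  with x have "x * e = - (x * e)" by simp
  then have "x * e + x * e = 0" by (simp only: eq_neg_iff_add_eq_0)
  then have "2 *\<^sub>R (x * e) = 0" by (simp only: scaleR_2)
  then have "x * e = 0" by simp
  then have "x * e * e = 0" by simp
  then have "x = 0" by (simp add: mult.assoc ee)
  moreover have "k * (k * y) = 0" using xy \<open>x = 0\<close> by simp
  then have "y = 0" by (simp add: kk flip: mult.assoc)
  ultimately show ?thesis by (simp add: x_def y_def)
qed

text \<open>The cross term is the real part of \<open>z * k\<close> with \<open>z\<close> in the
  slice. That product anticommutes with \<open>e\<close>, so cyclicity of the real part makes it its
  own negative.\<close>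

lemma norm_sq_decomp: "(norm u)\<^sup>2 = (norm (A u))\<^sup>2 + (norm (B u))\<^sup>2"
proof -
  define z where "z = qinner (A u) (B u)"
  have z: "e * z = z * e"
    using qinner_K[OF A_in_K B_in_K] by (simp add: z_def slice_iff)
  have "qre (z * k) = - qre (z * k * e * e)" by (simp add: mult.assoc ee)
  also have "\<dots> = - qre (e * z * k * e)" using qre_mult_commute[of "z * k * e" e] by (simp add: mult.assoc)
  also have "\<dots> = - qre (z * k)"
    by (simp add: z mult.assoc anticommute) (simp add: ee flip: mult.assoc)
  finally have "qre (z * k) = 0" by simp
  then show ?thesis
    using norm_sq_add[of "A u" "B u *\<^sub>Q k"]
    by (simp add: A_B_sum norm_scaleQ_imag_unit[OF k] qinner_scaleQ_right z_def)
qed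

section \<open>The extension: existence, uniqueness, commutation with \<open>f\<close>\<close>

definition ext :: "('h \<rightharpoonup> 'h) \<Rightarrow> ('h \<rightharpoonup> 'h)" where
  "ext T u = (case (T (A u), T (B u)) of (Some a, Some b) \<Rightarrow> Some (a + b *\<^sub>Q k) | _ \<Rightarrow> None)"

text \<open>The graph of \<^term>\<open>ext T\<close> is described componentwise; this reduces most claims to claims on \<open>T\<close>.\<close>

lemma ext_Some_iff:
  assumes "\<And>u u'. T u = Some u' \<Longrightarrow> u' \<in> K"
  shows "ext T u = Some w \<longleftrightarrow> T (A u) = Some (A w) \<and> T (B u) = Some (B w)"
  using assms A_sum B_sum A_B_sum[of w]
  by (auto simp: ext_def split: option.splits)

lemma dom_ext: "u \<in> dom (ext T) \<longleftrightarrow> A u \<in> dom T \<and> B u \<in> dom T"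
  by (auto simp: ext_def split: option.splits)

text \<open>Serves both readings of a one-sided inverse: \<open>D\<close> is \<open>K\<close> for
  the identity of the whole space, or a domain for the identity on that domain.\<close>

lemma ext_id_op: "ext (id_op D) = id_op {u. A u \<in> D \<and> B u \<in> D}"
  by (auto simp: ext_def id_op_def restrict_map_def A_B_sum)

context
  fixes T assumes T: "linear_op (slice e) K T"
begin

lemmas T_lin = linear_opD[OF T]

lemma ext_T_iff: "ext T u = Some w \<longleftrightarrow> T (A u) = Some (A w) \<and> T (B u) = Some (B w)"
  by (rule ext_Some_iff) (rule T_lin(2))

lemma linear_op_ext: "linear_op UNIV UNIV (ext T)"
proof (rule linear_opI)
  show "ext T 0 = Some 0"
    by (simp add: ext_T_iff A_zero B_zero T_lin(3))
  show "ext T (u + v) = Some (u' + v')" if "ext T u = Some u'" "ext T v = Some v'" for u u' v v'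
    using that T_lin(4) by (simp add: ext_T_iff A_add B_add)
  show "ext T (u *\<^sub>Q q) = Some (u' *\<^sub>Q q)" if u: "ext T u = Some u'" for u u' q
  proof -
    \<comment> \<open>\<open>T\<close> respects slice scalars only; splitting \<open>q\<close> makes
      both components of \<open>u *\<^sub>Q q\<close> slice combinations of \<open>A u\<close> and
      \<open>B u\<close>.\<close>
    obtain z w where zw: "z \<in> slice e" "w \<in> slice e" and q: "q = z + w * k"
      by (rule quat_decomp)
    have "- (k * z * k) \<in> slice e"
      using slice_k[OF zw(1)] by (simp add: slice_iff)
    then show ?thesis
      using u zw slice_k[OF zw(2)] unfolding q ext_T_iff A_scaleQ[OF zw] B_scaleQ[OF zw]
      by (intro conjI T_lin(4,5)) auto
  qed
qed simp

lemma ext_f: "ext T u = Some v \<Longrightarrow> ext T (f u) = Some (f v)"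
  by (simp add: ext_T_iff A_f B_f T_lin(5) e_in_slice)

lemma ext_commute: "(\<lambda>u. Some (f u)) \<circ>\<^sub>m ext T = ext T \<circ>\<^sub>m (\<lambda>u. Some (f u))"
proof
  fix u
  show "((\<lambda>u. Some (f u)) \<circ>\<^sub>m ext T) u = (ext T \<circ>\<^sub>m (\<lambda>u. Some (f u))) u"
  proof (cases "ext T u")
    case (Some v)
    then show ?thesis by (simp add: ext_f)
  next
    case None
    \<comment> \<open>Equal domains require that \<open>u\<close> is in the domain whenever
      \<open>f u\<close> is; applying \<open>f\<close> once more leads to
      \<open>- u\<close>.\<close>
    have "ext T (f u) = None"
    proof (rule ccontr)
      assume "ext T (f u) \<noteq> None"
      then obtain w where "ext T (f u) = Some w" by auto
      then have "ext T (- u) = Some (f w)" using ext_f f_f by metis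
      from linear_opD(5)[OF linear_op_ext this, of "- 1"] show False
        using None by (simp add: scaleQ_one)
    qed
    with None show ?thesis by simp
  qed
qed

lemma is_extension_ext: "is_extension (\<lambda>u. Some (f u)) K T (ext T)"
  unfolding is_extension_def
proof (intro conjI ballI)
  show "invariant_under (\<lambda>u. Some (f u)) (dom (ext T))"
    using ext_f by (auto simp: invariant_under_def)
  show "dom (ext T) \<inter> K = dom T"
  proof (rule set_eqI)
    \<comment> \<open>A vector of \<open>K\<close> has second component \<open>0\<close>, which
      always lies in \<open>dom T\<close>.\<close>
    have "0 \<in> dom T" "dom T \<subseteq> K" using T_lin(1,3) by auto
    then show "u \<in> dom (ext T) \<inter> K \<longleftrightarrow> u \<in> dom T" for u
      unfolding Int_iff dom_ext using A_K[of u] B_K[of u] by fastforce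
  qed
  show "ext T u = T u" if "u \<in> dom T" for u
    using that T_lin(1-3) by (auto simp: ext_def A_K B_K)
qed (rule linear_op_ext)

lemma is_extension_unique:
  assumes "is_extension (\<lambda>u. Some (f u)) K T V"
  shows "V = ext T"
proof
  fix u
  have V: "linear_op UNIV UNIV V" and inv: "\<And>u. u \<in> dom V \<Longrightarrow> f u \<in> dom V"
    and dom: "dom V \<inter> K = dom T" and VT: "\<And>u. u \<in> dom T \<Longrightarrow> V u = T u"
    using assms by (auto simp: is_extension_def invariant_under_def)
  have add: "u + v \<in> dom V" if "u \<in> dom V" "v \<in> dom V" for u v
    using that linear_opD(4)[OF V] by (auto simp: dom_def)
  have scale: "u *\<^sub>Q q \<in> dom V" if "u \<in> dom V" for u q
    using that linear_opD(5)[OF V] by (auto simp: dom_def)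
  have minus: "- u \<in> dom V" if "u \<in> dom V" for u
    using scale[OF that, of "- 1"] by (simp add: scaleQ_one)
  have scaleR: "r *\<^sub>R u \<in> dom V" if "u \<in> dom V" for u r
    using scale[OF that, of "of_real r"] by (simp add: scaleQ_of_real)
  have "A u \<in> dom V" "B u \<in> dom V" if "u \<in> dom V"
    unfolding A_def B_def diff_conv_add_uminus
    by (intro add scale minus scaleR inv that)+
  then have AB: "A u \<in> dom T" "B u \<in> dom T" if "u \<in> dom V"
    using that dom A_in_K B_in_K by blast+
  show "V u = ext T u"
  proof (cases "A u \<in> dom T \<and> B u \<in> dom T")
    case True
    then obtain a b where ab: "T (A u) = Some a" "T (B u) = Some b" by auto
    then have "V (A u) = Some a" "V (B u) = Some b" using True VT by simp_all
    then have "V (A u + B u *\<^sub>Q k) = Some (a + b *\<^sub>Q k)"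
      using linear_opD(4,5)[OF V] by simp
    with ab show ?thesis by (simp add: A_B_sum ext_def)
  next
    \<comment> \<open>Some component leaves \<open>dom T\<close>, so \<open>u\<close> is outside
      \<open>dom V\<close> as well and both values are \<open>None\<close>.\<close>
    case False
    with AB dom_ext[of u T] show ?thesis by (auto simp: dom_def)
  qed
qed

lemma tilde_eq_ext: "tilde (\<lambda>u. Some (f u)) K T = ext T"
  unfolding tilde_def using is_extension_ext is_extension_unique by (rule the_equality)

section \<open>Boundedness and the operator norm\<close>

lemma norm_ext_le:
  assumes M: "\<And>u u'. T u = Some u' \<Longrightarrow> norm u' \<le> M * norm u" and "0 \<le> M" and "ext T u = Some w"
  shows "norm w \<le> M * norm u"
proof (rule power2_le_imp_le)
  have "T (A u) = Some (A w)" "T (B u) = Some (B w)"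
    using assms(3) by (simp_all add: ext_T_iff)
  \<comment> \<open>Squared bounds for the components add up by Pythagoras, with the same
    constant.\<close>
  from this[THEN M] have "(norm (A w))\<^sup>2 \<le> (M * norm (A u))\<^sup>2" "(norm (B w))\<^sup>2 \<le> (M * norm (B u))\<^sup>2"
    by (auto intro: power_mono)
  then show "(norm w)\<^sup>2 \<le> (M * norm u)\<^sup>2"
    by (simp add: norm_sq_decomp[of w] norm_sq_decomp[of u] power_mult_distrib distrib_left)
qed (simp add: assms(2))

lemma bounded_op_ext:
  assumes bounded: "bounded_op (slice e) K T"
  shows "bounded_op UNIV UNIV (ext T)" "op_norm (ext T) = op_norm T"
proof -
  let ?q = "\<lambda>(S :: 'h \<rightharpoonup> 'h) u. norm (the (S u)) / norm u"
  obtain M where dom: "dom T = K" and M: "\<And>u. u \<in> K \<Longrightarrow> norm (the (T u)) \<le> M * norm u"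
    using bounded by (auto simp: bounded_op_def)
  \<comment> \<open>At \<open>u = 0\<close> the quotient is \<open>0 / 0 = 0\<close>, and the bound
    holds there because \<open>S 0 = Some 0\<close>.\<close>
  have le_iff: "?q S u \<le> N \<longleftrightarrow> norm (the (S u)) \<le> N * norm u" if "S 0 = Some 0" "0 \<le> N"
    for S :: "'h \<rightharpoonup> 'h" and N u
    using that by (cases "u = 0") (auto simp: divide_le_eq)
  have ext0: "ext T 0 = Some 0" by (rule linear_opD(3)[OF linear_op_ext])
  have dom_UNIV: "dom (ext T) = UNIV"
    using dom A_in_K B_in_K dom_ext[of _ T] by blast
  \<comment> \<open>\<open>M\<close> is not known to be nonnegative.\<close>
  have "?q T u \<le> max M 0" if "u \<in> dom T" for u
  proof -
    have "M * norm u \<le> max M 0 * norm u" by (intro mult_right_mono) auto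
    then show ?thesis
      using M[of u] that dom by (subst le_iff[where S = T, OF T_lin(3)]) auto
  qed
  then have bdd: "bdd_above (?q T ` dom T)" by (auto intro!: bdd_aboveI)
  define N where "N = op_norm T"
  have qN: "?q T u \<le> N" if "u \<in> dom T" for u
    unfolding N_def op_norm_def using bdd that by (rule cSUP_upper2) simp
  have N0: "0 \<le> N" using qN[of 0] T_lin(3) by auto
  have "norm u' \<le> N * norm u" if "T u = Some u'" for u u'
    using qN[of u] that unfolding le_iff[where S = T, OF T_lin(3) N0] by auto
  from norm_ext_le[OF this N0] have extN: "norm (the (ext T u)) \<le> N * norm u" for u
    using dom_UNIV by (metis UNIV_I domD option.sel)
  then show "bounded_op UNIV UNIV (ext T)"
    using linear_op_ext dom_UNIV by (auto simp: bounded_op_def)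
  have extq: "?q (ext T) u \<le> N" for u
    using extN by (simp add: le_iff[where S = "ext T", OF ext0 N0])
  show "op_norm (ext T) = op_norm T"
  proof (rule antisym)
    show "op_norm (ext T) \<le> op_norm T"
      using extq unfolding op_norm_def[of "ext T"] N_def dom_UNIV by (intro cSUP_least) auto
    \<comment> \<open>For the reverse inequality, \<open>ext T\<close> agrees with \<open>T\<close>
      on \<open>dom T\<close>, so its supremum runs over at least the same quotients.\<close>
    have "bdd_above (?q (ext T) ` UNIV)" using extq by (auto intro!: bdd_aboveI)
    moreover have "ext T u = T u" if "u \<in> dom T" for u
      using is_extension_ext that by (simp add: is_extension_def)
    ultimately have "?q T u \<le> op_norm (ext T)" if "u \<in> dom T" for u
      unfolding op_norm_def dom_UNIV using that cSUP_upper[of u UNIV "?q (ext T)"] by simp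
    then show "op_norm T \<le> op_norm (ext T)"
      unfolding op_norm_def[of T] using T_lin(3) by (intro cSUP_least) auto
  qed
qed

section \<open>Density and adjoints\<close>

lemma closure_dom_ext:
  assumes "K \<subseteq> closure (dom T)"
  shows "closure (dom (ext T)) = UNIV"
proof -
  have "u \<in> closure (dom (ext T))" for u
    unfolding closure_approachable
  proof (intro allI impI)
    fix r :: real assume "0 < r"
    \<comment> \<open>Half the radius goes to each component, as right multiplication by
      \<open>k\<close> preserves distances.\<close>
    then have r: "0 < r / 2" by simp
    have "A u \<in> closure (dom T)" "B u \<in> closure (dom T)"
      using assms A_in_K B_in_K by blast+
    then obtain a b where a: "a \<in> dom T" "dist a (A u) < r / 2" and b: "b \<in> dom T" "dist b (B u) < r / 2"
      unfolding closure_approachable using r by blast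
    have "a + b *\<^sub>Q k \<in> dom (ext T)"
      using a(1) b(1) T_lin(1) by (auto simp: dom_ext A_sum B_sum)
    moreover have "dist (a + b *\<^sub>Q k) (A u + B u *\<^sub>Q k) \<le> dist a (A u) + dist (b *\<^sub>Q k) (B u *\<^sub>Q k)"
      by (rule dist_triangle_add)
    then have "dist (a + b *\<^sub>Q k) u < r"
      using a(2) b(2)
      by (simp add: A_B_sum dist_norm norm_scaleQ_imag_unit[OF k] flip: scaleQ_diff_left)
    ultimately show "\<exists>v\<in>dom (ext T). dist v u < r" by blast
  qed
  then show ?thesis by blast
qed

context
  assumes dense: "K \<subseteq> closure (dom T)"
begin

lemma adjoint_iff: "op_adjoint K T u = Some w \<longleftrightarrow>
    u \<in> K \<and> w \<in> K \<and> (\<forall>v v'. T v = Some v' \<longrightarrow> qinner w v = qinner u v')"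
  by (rule op_adjoint_Some_iff[OF dense]) (rule K_diff)

text \<open>Allows \<open>tilde\<close> of the adjoint to be computed as \<open>ext\<close>.\<close>

lemma linear_op_adjoint: "linear_op (slice e) K (op_adjoint K T)"
proof (rule linear_opI)
  fix u u' z assume *: "op_adjoint K T u = Some u'" and z: "z \<in> slice e"
  then show "op_adjoint K T (u *\<^sub>Q z) = Some (u' *\<^sub>Q z)"
    by (simp add: adjoint_iff K_scaleQ qinner_scaleQ_left)
qed (auto simp: adjoint_iff K_zero K_add qinner_add_left)

text \<open>Both sides amount to the adjoint relation tested on \<open>dom T\<close>, for the
  \<open>A\<close> and \<open>B\<close> components separately. Testing on \<open>dom T\<close>
  separates them; sesquilinearity recovers the relation on \<open>dom (ext T)\<close>.\<close>

lemma adjoint_ext: "op_adjoint UNIV (ext T) = ext (op_adjoint K T)"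
proof -
  have dense': "UNIV \<subseteq> closure (dom (ext T))" using closure_dom_ext[OF dense] by simp
  have "op_adjoint UNIV (ext T) u = Some w \<longleftrightarrow> ext (op_adjoint K T) u = Some w" for u w
  proof -
    have ext_adj: "ext (op_adjoint K T) u = Some w \<longleftrightarrow>
        op_adjoint K T (A u) = Some (A w) \<and> op_adjoint K T (B u) = Some (B w)"
      by (rule ext_Some_iff) (simp add: adjoint_iff)
    have "op_adjoint UNIV (ext T) u = Some w \<longleftrightarrow>
        (\<forall>v v'. ext T v = Some v' \<longrightarrow> qinner w v = qinner u v')"
      by (simp add: op_adjoint_Some_iff[OF dense'])
    also have "\<dots> \<longleftrightarrow> (\<forall>v v'. T v = Some v' \<longrightarrow> qinner (A w) v = qinner (A u) v' \<and> qinner (B w) v = qinner (B u) v')"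
    proof (intro iffI allI impI)
      fix v v' assume *: "\<forall>v v'. ext T v = Some v' \<longrightarrow> qinner w v = qinner u v'" and v: "T v = Some v'"
      then have K: "v \<in> K" "v' \<in> K" using T_lin(1,2) by blast+
      then have "ext T v = Some v'" using v T_lin(3) by (simp add: ext_T_iff A_K B_K)
      with * have "qinner (A w + B w *\<^sub>Q k) v = qinner (A u + B u *\<^sub>Q k) v'" by (simp add: A_B_sum)
      \<comment> \<open>In the left argument \<open>k\<close> comes out conjugated, that is as
        \<open>- k\<close>; the sign is moved onto the slice factor.\<close>
      then have "qinner (A w) v + k * (- qinner (B w) v) = qinner (A u) v' + k * (- qinner (B u) v')"
        by (simp add: qinner_add_left qinner_scaleQ_left qconj_imag_unit[OF k])
      moreover have "- qinner (B w) v \<in> slice e" "- qinner (B u) v' \<in> slice e"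
        using qinner_K[OF B_in_K K(1)] qinner_K[OF B_in_K K(2)] by (simp_all add: slice_iff)
      ultimately show "qinner (A w) v = qinner (A u) v' \<and> qinner (B w) v = qinner (B u) v'"
        using slice_add_k_eq[OF qinner_K[OF A_in_K K(1)] _ qinner_K[OF A_in_K K(2)]] by (metis neg_equal_iff_equal)
    next
      fix v v'
      assume *: "\<forall>v v'. T v = Some v' \<longrightarrow> qinner (A w) v = qinner (A u) v' \<and> qinner (B w) v = qinner (B u) v'"
        and "ext T v = Some v'"
      then have T: "T (A v) = Some (A v')" "T (B v) = Some (B v')" by (simp_all add: ext_T_iff)
      have "qinner (A w + B w *\<^sub>Q k) (A v + B v *\<^sub>Q k) = qinner (A u + B u *\<^sub>Q k) (A v' + B v' *\<^sub>Q k)"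
        using *[rule_format, OF T(1)] *[rule_format, OF T(2)]
        by (simp add: qinner_add_left qinner_add_right qinner_scaleQ_left qinner_scaleQ_right)
      then show "qinner w v = qinner u v'" by (simp add: A_B_sum)
    qed
    also have "\<dots> \<longleftrightarrow> ext (op_adjoint K T) u = Some w"
      unfolding ext_adj by (auto simp: adjoint_iff A_in_K B_in_K)
    finally show ?thesis .
  qed
  \<comment> \<open>\<open>HOL.ext\<close> is function extensionality, not the extension defined
    here.\<close>
  then show ?thesis by (intro HOL.ext) (metis option.exhaust)
qed

end

end

section \<open>Compositions and restrictions\<close>

lemma ext_comp:
  assumes S: "linear_op (slice e) K S" and T: "linear_op (slice e) K T"
  shows "ext (S \<circ>\<^sub>m T) = ext S \<circ>\<^sub>m ext T"
proof -
  note iff = ext_T_iff[OF S] ext_T_iff[OF T] ext_T_iff[OF linear_op_comp[OF S T]]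
  have "ext (S \<circ>\<^sub>m T) u = Some w \<longleftrightarrow> (ext S \<circ>\<^sub>m ext T) u = Some w" for u w
  proof
    assume "ext (S \<circ>\<^sub>m T) u = Some w"
    then obtain a b where ab: "T (A u) = Some a" "S a = Some (A w)" "T (B u) = Some b" "S b = Some (B w)"
      by (auto simp: iff map_comp_Some_iff)
    moreover from ab have "a \<in> K" "b \<in> K" using linear_opD(2)[OF T] by blast+
    \<comment> \<open>The intermediate vector is \<open>a + b *\<^sub>Q k\<close>; its components
      are \<open>a\<close> and \<open>b\<close> because both lie in \<open>K\<close>.\<close>
    ultimately show "(ext S \<circ>\<^sub>m ext T) u = Some w"
      by (auto simp: map_comp_Some_iff iff A_sum B_sum intro!: exI[of _ "a + b *\<^sub>Q k"])
  qed (auto simp: iff map_comp_Some_iff)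
  then show ?thesis by (intro HOL.ext) (metis option.exhaust)
qed

text \<open>For \<open>u\<close> in \<open>K\<close>, commutation gives
  \<open>f (V u) = V (f u) = V (u e) = (V u) e\<close>, so \<open>V\<close> maps the part of its
  domain in \<open>K\<close> into \<open>K\<close> and extends its own restriction.\<close>

lemma is_extension_restrict:
  assumes V: "linear_op UNIV UNIV V" and inv: "invariant_under (\<lambda>u. Some (f u)) (dom V)"
    and commute: "(\<lambda>u. Some (f u)) \<circ>\<^sub>m V = V \<circ>\<^sub>m (\<lambda>u. Some (f u))"
  shows "linear_op (slice e) K (V |` K)" "is_extension (\<lambda>u. Some (f u)) K (V |` K) V"
proof -
  have Vf: "V (f u) = Some (f v)" if "V u = Some v" for u v
    using fun_cong[OF commute, of u] that by simp
  have "u' \<in> K" if "u \<in> K" "V u = Some u'" for u u'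
    using Vf[OF that(2)] linear_opD(5)[OF V that(2), of e] that(1) by (simp add: K_def)
  then show "linear_op (slice e) K (V |` K)"
    by (intro linear_opI)
      (auto simp: restrict_map_def K_zero K_add K_scaleQ linear_opD(3)[OF V]
        intro: linear_opD(4,5)[OF V] split: if_splits)
  show "is_extension (\<lambda>u. Some (f u)) K (V |` K) V"
    using V inv by (auto simp: is_extension_def restrict_map_def split: if_splits)
qed

end


section \<open>From \<open>J\<close> to the decomposition, and assembly of the claims\<close>

lemma anti_self_adjoint_unitary_cases:
  fixes J :: "'h::quaternionic_hilbert \<rightharpoonup> 'h"
  assumes "bounded_op UNIV UNIV J" "anti_self_adjoint J" "unitary_op J" "\<iota> \<in> imag_units"
    and K: "K = H_plus J \<iota> \<or> K = H_minus J \<iota>"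
  obtains f e k where "J = (\<lambda>u. Some (f u))" "eigenspace_decomposition f e k" "slice e = slice \<iota>"
    "K = eigenspace_decomposition.K f e"
proof -
  define f where "f u = the (J u)" for u
  have lin: "linear_op UNIV UNIV J" and dom: "dom J = UNIV"
    using assms(1) by (simp_all add: bounded_op_def)
  have J: "J u = Some (f u)" for u using dom by (metis UNIV_I domD f_def option.sel)
  have adj: "op_adjoint UNIV J u = Some (- f u)" for u
    using assms(2) by (simp add: anti_self_adjoint_def J)
  \<comment> \<open>The minus eigenspace also has the form \<open>f u = u *\<^sub>Q e\<close>, with
    the sign absorbed into \<open>e\<close>.\<close>
  define e where "e = (if K = H_plus J \<iota> then \<iota> else - \<iota>)"
  have "e \<in> imag_units" using assms(4) by (simp add: e_def imag_units_iff)
  then obtain k where k: "k \<in> imag_units" "k * e = - (e * k)" by (rule imag_units_anticommuting)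
  have dec: "eigenspace_decomposition f e k"
  proof
    show "f (u + v) = f u + f v" "f (u *\<^sub>Q q) = f u *\<^sub>Q q" for u v q
      using linear_opD(4,5)[OF lin] by (simp_all add: J)
    \<comment> \<open>Since the adjoint is \<open>- f\<close>, this identity reads
      \<open>- f (f u) = u\<close>.\<close>
    have "(op_adjoint UNIV J \<circ>\<^sub>m J) u = Some u" for u
      using assms(3) by (simp add: unitary_op_def id_op_def)
    then show "f (f u) = - u" for u by (simp add: J adj neg_eq_iff_add_eq_0 eq_neg_iff_add_eq_0)
    have "qinner (- f u) v = qinner u (f v)" for u v
      using op_adjoint_Some_iff[of UNIV J u "- f u"] by (simp add: dom adj J)
    then show "qinner (f u) v = - qinner u (f v)" for u v
      by (simp add: neg_eq_iff_add_eq_0 eq_neg_iff_add_eq_0)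
  qed fact+
  show ?thesis
  proof (rule that)
    show "slice e = slice \<iota>" by (simp add: e_def slice_uminus)
    show "J = (\<lambda>u. Some (f u))" by (rule ext) (rule J)
    show "eigenspace_decomposition f e k" by (rule dec)
    show "K = eigenspace_decomposition.K f e"
    proof (cases "K = H_plus J \<iota>")
      case True
      then have "e = \<iota>" by (simp add: e_def)
      with True show ?thesis
        unfolding eigenspace_decomposition.K_def[OF dec] by (simp add: H_plus_def J)
    next
      case False
      with K have "K = H_minus J \<iota>" "e = - \<iota>" by (simp_all add: e_def)
      then show ?thesis
        unfolding eigenspace_decomposition.K_def[OF dec] by (simp add: H_minus_def J)
    qed
  qed
qed

theorem proposition3p11:
  fixes J :: "'h::quaternionic_hilbert \<rightharpoonup> 'h" and \<iota> :: quat and K :: "'h set"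
  assumes "bounded_op UNIV UNIV J" and "anti_self_adjoint J" and "unitary_op J"
    and "\<iota> \<in> imag_units"
    and "K = H_plus J \<iota> \<or> K = H_minus J \<iota>"
  shows
    "(\<forall>T. linear_op (slice \<iota>) K T \<longrightarrow>
        (\<exists>!V. is_extension J K T V) \<and>
        (bounded_op (slice \<iota>) K T \<longrightarrow>
           bounded_op UNIV UNIV (tilde J K T) \<and> op_norm (tilde J K T) = op_norm T) \<and>
        J \<circ>\<^sub>m tilde J K T = tilde J K T \<circ>\<^sub>m J \<and>
        (K \<subseteq> closure (dom T) \<longrightarrow>
           closure (dom (tilde J K T)) = UNIV \<and>
           op_adjoint UNIV (tilde J K T) = tilde J K (op_adjoint K T))) \<and>
     (\<forall>V. linear_op UNIV UNIV V \<longrightarrow>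
        ((\<exists>U. linear_op (slice \<iota>) K U \<and> dom U = dom V \<inter> K \<and> V = tilde J K U) \<longleftrightarrow>
         invariant_under J (dom V) \<and> J \<circ>\<^sub>m V = V \<circ>\<^sub>m J)) \<and>
     (\<forall>S T. linear_op (slice \<iota>) K S \<and> linear_op (slice \<iota>) K T \<longrightarrow>
        tilde J K (S \<circ>\<^sub>m T) = tilde J K S \<circ>\<^sub>m tilde J K T \<and>
        (T \<circ>\<^sub>m S = id_op K \<longrightarrow> tilde J K T \<circ>\<^sub>m tilde J K S = id_op UNIV) \<and>
        (S \<circ>\<^sub>m T = id_op K \<longrightarrow> tilde J K S \<circ>\<^sub>m tilde J K T = id_op UNIV) \<and>
        (T \<circ>\<^sub>m S = id_op (dom S) \<longrightarrow>
           tilde J K T \<circ>\<^sub>m tilde J K S = id_op (dom (tilde J K S))) \<and>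
        (S \<circ>\<^sub>m T = id_op (dom T) \<longrightarrow>
           tilde J K S \<circ>\<^sub>m tilde J K T = id_op (dom (tilde J K T))))"
proof -
  obtain f e k where J: "J = (\<lambda>u. Some (f u))" and dec: "eigenspace_decomposition f e k"
    and slice: "slice \<iota> = slice e" and K: "K = eigenspace_decomposition.K f e"
    using anti_self_adjoint_unitary_cases[OF assms] by metis
  interpret eigenspace_decomposition f e k by (rule dec)
  have id_K: "ext (id_op local.K) = id_op UNIV"
    by (simp add: ext_id_op A_in_K B_in_K)
  have id_dom: "ext (id_op (dom T)) = id_op (dom (ext T))" for T
    unfolding ext_id_op dom_ext[symmetric] Collect_mem_eq ..
  show ?thesis
    unfolding slice K J
  proof (intro conjI allI impI; (elim conjE)?)
    fix T assume T: "linear_op (slice e) local.K T"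
    note tilde_T = tilde_eq_ext[OF T]
    show "\<exists>!V. is_extension (\<lambda>u. Some (f u)) local.K T V"
      using is_extension_ext[OF T] is_extension_unique[OF T] by blast
    show "(\<lambda>u. Some (f u)) \<circ>\<^sub>m tilde (\<lambda>u. Some (f u)) local.K T =
        tilde (\<lambda>u. Some (f u)) local.K T \<circ>\<^sub>m (\<lambda>u. Some (f u))"
      unfolding tilde_T by (rule ext_commute[OF T])
    show "bounded_op UNIV UNIV (tilde (\<lambda>u. Some (f u)) local.K T)"
      "op_norm (tilde (\<lambda>u. Some (f u)) local.K T) = op_norm T"
      if "bounded_op (slice e) local.K T"
      unfolding tilde_T using that by (rule bounded_op_ext[OF T])+
    assume dense: "local.K \<subseteq> closure (dom T)"
    show "closure (dom (tilde (\<lambda>u. Some (f u)) local.K T)) = UNIV"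
      unfolding tilde_T by (rule closure_dom_ext[OF T dense])
    show "op_adjoint UNIV (tilde (\<lambda>u. Some (f u)) local.K T) =
        tilde (\<lambda>u. Some (f u)) local.K (op_adjoint local.K T)"
      unfolding tilde_T tilde_eq_ext[OF linear_op_adjoint[OF T dense]] by (rule adjoint_ext[OF T dense])
  next
    fix V :: "'h \<rightharpoonup> 'h"
    assume V: "linear_op UNIV UNIV V"
    show "(\<exists>U. linear_op (slice e) local.K U \<and> dom U = dom V \<inter> local.K \<and>
          V = tilde (\<lambda>u. Some (f u)) local.K U) \<longleftrightarrow>
        invariant_under (\<lambda>u. Some (f u)) (dom V) \<and>
          (\<lambda>u. Some (f u)) \<circ>\<^sub>m V = V \<circ>\<^sub>m (\<lambda>u. Some (f u))"
      (is "?lhs \<longleftrightarrow> ?rhs")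
    proof
      assume ?lhs
      then obtain U where U: "linear_op (slice e) local.K U" and "V = tilde (\<lambda>u. Some (f u)) local.K U"
        by blast
      then have "V = ext U" by (simp add: tilde_eq_ext)
      with is_extension_ext[OF U] ext_commute[OF U] show ?rhs by (simp add: is_extension_def)
    next
      assume ?rhs
      \<comment> \<open>The witness is the restriction of \<open>V\<close> to \<open>K\<close>;
        uniqueness of extensions then identifies \<open>V\<close> with its
        \<open>tilde\<close>.\<close>
      note U = is_extension_restrict[OF V conjunct1[OF this] conjunct2[OF this]]
      have "V = tilde (\<lambda>u. Some (f u)) local.K (V |` local.K)"
        using is_extension_unique[OF U] tilde_eq_ext[OF U(1)] by simp
      with U(1) show ?lhs by (intro exI[of _ "V |` local.K"]) simp
    qed
  next
    fix S T assume S: "linear_op (slice e) local.K S" and T: "linear_op (slice e) local.K T"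
    \<comment> \<open>Merging composed extensions reduces each inverse claim to the extension of an
      identity, given by \<open>id_K\<close> or \<open>id_dom\<close>.\<close>
    note simps = tilde_eq_ext[OF S] tilde_eq_ext[OF T] tilde_eq_ext[OF linear_op_comp[OF S T]]
      ext_comp[OF S T, symmetric] ext_comp[OF T S, symmetric]
    show "tilde (\<lambda>u. Some (f u)) local.K (S \<circ>\<^sub>m T) =
        tilde (\<lambda>u. Some (f u)) local.K S \<circ>\<^sub>m tilde (\<lambda>u. Some (f u)) local.K T"
      by (simp add: simps)
    show "tilde (\<lambda>u. Some (f u)) local.K T \<circ>\<^sub>m tilde (\<lambda>u. Some (f u)) local.K S = id_op UNIV"
      if "T \<circ>\<^sub>m S = id_op local.K" using that by (simp add: simps id_K)
    show "tilde (\<lambda>u. Some (f u)) local.K S \<circ>\<^sub>m tilde (\<lambda>u. Some (f u)) local.K T = id_op UNIV"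
      if "S \<circ>\<^sub>m T = id_op local.K" using that by (simp add: simps id_K)
    show "tilde (\<lambda>u. Some (f u)) local.K T \<circ>\<^sub>m tilde (\<lambda>u. Some (f u)) local.K S =
        id_op (dom (tilde (\<lambda>u. Some (f u)) local.K S))"
      if "T \<circ>\<^sub>m S = id_op (dom S)" using that by (simp add: simps id_dom)
    show "tilde (\<lambda>u. Some (f u)) local.K S \<circ>\<^sub>m tilde (\<lambda>u. Some (f u)) local.K T =
        id_op (dom (tilde (\<lambda>u. Some (f u)) local.K T))"
      if "S \<circ>\<^sub>m T = id_op (dom T)" using that by (simp add: simps id_dom)
  qed
qed

end
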